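(* Let $X$ be a Tychonoff space and let $K_X$ be the set of isolated points of $X$, with $|K_X|\geq 3$. Then $$\chi(AG(C_F(X)))=cl(AG(C_F(X)))=\begin{cases}\binom{|K_X|}{\lfloor |K_X|/2\rfloor}, & \text{if } |K_X| \text{ is finite},\\ |K_X|, & \text{otherwise.}\end{cases}$$
   Context: $C(X)$ is the ring of all real valued continuous functions on the Tychonoff (completely regular Hausdorff) space $X$; $Z(f)=\{x\in X: f(x)=0\}$; $C_F(X)=\{f\in C(X): X\setminus Z(f)\text{ is finite}\}$, a commutative ring (possibly without identity). For a commutative ring $R$, $Z(R)^*$ is the set of nonzero zero divisors, i.e. nonzero $a\in R$ with $ab=0$ for some nonzero $b\in R$, and $ann(a)=\{r\in R: ra=0\}$. The annihilator graph $AG(R)$ is the simple graph with vertex set $Z(R)^*$ in which distinct $a,b$ are adjacent iff $ann(a)\cup ann(b)\neq ann(ab)$. The clique number $cl(H)$ of a graph $H$ is the supremum of the cardinalities (finite or infinite) of sets of pairwise adjacent vertices. The chromatic number $\chi(H)$ is the least cardinal $\Lambda$ (finite or infinite) such that the vertices of $H$ can be labeled with $\Lambda$ colors so that adjacent vertices receive different colors. *)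

theory Defs
  imports "HOL-Analysis.Analysis" "HOL-Library.Function_Algebras"
begin

text \<open>\<open>=o\<close> is freed for isomorphism of cardinals.\<close>
no_notation Set_Algebras.elt_set_eq (infix \<open>=o\<close> 50)

unbundle cardinal_syntax

section \<open>Simple graphs, clique number and chromatic number\<close>

record 'v sgraph =
  vertices :: "'v set"
  adjacent :: "'v \<Rightarrow> 'v \<Rightarrow> bool"

definition simple_graph :: "'v sgraph \<Rightarrow> bool" where
  "simple_graph G \<longleftrightarrow>
     (\<forall>u\<in>vertices G. \<not> adjacent G u u) \<and>
     (\<forall>u\<in>vertices G. \<forall>v\<in>vertices G. adjacent G u v \<longrightarrow> adjacent G v u)"

definition clique :: "'v sgraph \<Rightarrow> 'v set \<Rightarrow> bool" where
  "clique G S \<longleftrightarrow> S \<subseteq> vertices G \<and> pairwise (adjacent G) S"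

definition proper_colouring :: "'v sgraph \<Rightarrow> 'c set \<Rightarrow> ('v \<Rightarrow> 'c) \<Rightarrow> bool" where
  "proper_colouring G C c \<longleftrightarrow> c ` vertices G \<subseteq> C \<and>
     (\<forall>u\<in>vertices G. \<forall>v\<in>vertices G. adjacent G u v \<longrightarrow> c u \<noteq> c v)"

text \<open>
  Cardinals, finite or infinite, are cardinal orders, taken up to the isomorphism \<open>=o\<close>.
  \<open>least_cardinal P\<close> is a least cardinal (unique up to \<open>=o\<close>) among those with property \<open>P\<close>.
  Below it is used for cardinals that live on the type of vertices. This is no restriction:
  the lemmas \<open>chromatic_number_least\<close> and \<open>clique_number_least\<close> show minimality among
  all cardinals, on any type.
\<close>

definition least_cardinal :: "('c rel \<Rightarrow> bool) \<Rightarrow> 'c rel" where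
  "least_cardinal P =
     (SOME r. Card_order r \<and> P r \<and> (\<forall>s. Card_order s \<and> P s \<longrightarrow> r \<le>o s))"

definition chromatic_number :: "'v sgraph \<Rightarrow> 'v rel" where
  "chromatic_number G =
     least_cardinal (\<lambda>r. \<exists>c. proper_colouring G (Field r) c)"

text \<open>The supremum of a set of cardinals is its least upper bound in the order \<open>\<le>o\<close>.\<close>

definition clique_number :: "'v sgraph \<Rightarrow> 'v rel" where
  "clique_number G = least_cardinal (\<lambda>r. \<forall>S. clique G S \<longrightarrow> |S| \<le>o r)"

lemma least_cardinal:
  assumes "Card_order r" "P r"
  shows "Card_order (least_cardinal P) \<and> P (least_cardinal P) \<and>
         (\<forall>s. Card_order s \<and> P s \<longrightarrow> least_cardinal P \<le>o s)"
proof -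
  have "\<exists>r\<in>{r. Card_order r \<and> P r}. \<forall>s\<in>{r. Card_order r \<and> P r}. r \<le>o s"
    by (rule exists_minim_Card_order) (use assms in auto)
  then have "\<exists>r. Card_order r \<and> P r \<and> (\<forall>s. Card_order s \<and> P s \<longrightarrow> r \<le>o s)"
    by auto
  from someI_ex[OF this] show ?thesis
    unfolding least_cardinal_def .
qed

lemma chromatic_number_on_type:
  fixes G :: "'v sgraph"
  assumes "simple_graph G"
  shows "Card_order (chromatic_number G) \<and>
    (\<exists>c. proper_colouring G (Field (chromatic_number G)) c) \<and>
    (\<forall>s :: 'v rel. Card_order s \<and> (\<exists>c. proper_colouring G (Field s) c) \<longrightarrow> chromatic_number G \<le>o s)"
  unfolding chromatic_number_def
proof (rule least_cardinal)
  show "Card_order |UNIV :: 'v set|" by (rule card_of_Card_order)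
  show "\<exists>c. proper_colouring G (Field |UNIV :: 'v set| ) c"
    using assms unfolding proper_colouring_def simple_graph_def Field_card_of
    by (intro exI[of _ "\<lambda>v. v"]) auto
qed

lemma chromatic_number_colouring:
  assumes "simple_graph G"
  shows "\<exists>c. proper_colouring G (Field (chromatic_number G)) c"
  using chromatic_number_on_type[OF assms] by blast

lemma chromatic_number_least:
  fixes G :: "'v sgraph" and C :: "'c set"
  assumes "simple_graph G" "proper_colouring G C c"
  shows "chromatic_number G \<le>o |C|"
proof -
  let ?D = "c ` vertices G"
  define g where "g = inv_into (vertices G) c"
  have inj: "inj_on g ?D" unfolding g_def by (rule inj_on_inv_into) simp
  have "proper_colouring G (Field |g ` ?D| ) (g \<circ> c)"
    unfolding proper_colouring_def Field_card_of
  proof (intro conjI ballI impI)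
    show "(g \<circ> c) ` vertices G \<subseteq> g ` ?D" by (simp add: image_comp)
    fix u v assume "u \<in> vertices G" "v \<in> vertices G" "adjacent G u v"
    then have "c u \<noteq> c v" "c u \<in> ?D" "c v \<in> ?D"
      using assms(2) unfolding proper_colouring_def by blast+
    then show "(g \<circ> c) u \<noteq> (g \<circ> c) v"
      using inj_onD[OF inj, of "c u" "c v"] by auto
  qed
  then have "chromatic_number G \<le>o |g ` ?D|"
    using chromatic_number_on_type[OF assms(1)] card_of_Card_order[of "g ` ?D"] by auto
  moreover have "|g ` ?D| \<le>o |?D|" by (rule card_of_image)
  moreover have "|?D| \<le>o |C|"
    using assms(2) unfolding proper_colouring_def by (intro card_of_mono1) blast
  ultimately show ?thesis using ordLeq_transitive by metis
qed

lemma clique_number_on_type: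
  fixes G :: "'v sgraph"
  shows "Card_order (clique_number G) \<and> (\<forall>S. clique G S \<longrightarrow> |S| \<le>o clique_number G) \<and>
    (\<forall>s :: 'v rel. Card_order s \<and> (\<forall>S. clique G S \<longrightarrow> |S| \<le>o s) \<longrightarrow> clique_number G \<le>o s)"
  unfolding clique_number_def
proof (rule least_cardinal)
  show "Card_order |UNIV :: 'v set|" by (rule card_of_Card_order)
  show "\<forall>S. clique G S \<longrightarrow> |S| \<le>o |UNIV :: 'v set|" by (simp add: card_of_mono1)
qed

lemma clique_number_upper:
  assumes "clique G S"
  shows "|S| \<le>o clique_number G"
  using clique_number_on_type assms by blast

lemma clique_number_least:
  fixes G :: "'v sgraph" and C :: "'c set"
  assumes "\<And>S. clique G S \<Longrightarrow> |S| \<le>o |C|"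
  shows "clique_number G \<le>o |C|"
proof (cases "|UNIV :: 'v set| \<le>o |C|")
  case True
  have "clique_number G \<le>o |UNIV :: 'v set|"
    using clique_number_on_type[of G] card_of_Card_order[of "UNIV :: 'v set"]
    using card_of_mono1[OF subset_UNIV] by metis
  then show ?thesis using True by (rule ordLeq_transitive)
next
  case False
  then have "|C| \<le>o |UNIV :: 'v set|"
    using ordLeq_total[OF card_of_Well_order card_of_Well_order] by metis
  then obtain B :: "'v set" where B: "|C| =o |B|"
    using internalize_card_of_ordLeq2[of C "UNIV :: 'v set"] by auto
  have "clique_number G \<le>o |B|"
    using clique_number_on_type[of G] ordLeq_ordIso_trans[OF assms B] card_of_Card_order[of B]
    by auto
  then show ?thesis using ordIso_symmetric[OF B] by (rule ordLeq_ordIso_trans)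
qed

section \<open>The annihilator graph of a commutative ring\<close>

text \<open>
  A commutative ring, possibly without identity, is given as a set \<open>R\<close> of elements of
  an ambient type of class \<^class>\<open>comm_ring\<close>, closed under the ring operations.
\<close>

definition subring_set :: "'r::comm_ring set \<Rightarrow> bool" where
  "subring_set R \<longleftrightarrow> 0 \<in> R \<and> (\<forall>a\<in>R. \<forall>b\<in>R. a - b \<in> R \<and> a * b \<in> R)"

definition ann :: "'r::comm_ring set \<Rightarrow> 'r \<Rightarrow> 'r set" where
  "ann R a = {r \<in> R. r * a = 0}"

definition nonzero_zero_divisors :: "'r::comm_ring set \<Rightarrow> 'r set" where
  "nonzero_zero_divisors R = {a \<in> R. a \<noteq> 0 \<and> (\<exists>b\<in>R. b \<noteq> 0 \<and> a * b = 0)}"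

definition AG :: "'r::comm_ring set \<Rightarrow> 'r sgraph" where
  "AG R = \<lparr>vertices = nonzero_zero_divisors R,
           adjacent = (\<lambda>a b. a \<noteq> b \<and> ann R a \<union> ann R b \<noteq> ann R (a * b))\<rparr>"

lemma simple_graph_AG: "simple_graph (AG R)"
  by (auto simp: simple_graph_def AG_def mult.commute Un_commute)

section \<open>Rings of continuous functions\<close>

text \<open>
  A real function on the space \<open>X\<close> is represented by its extension by \<open>0\<close> outside
  \<^term>\<open>topspace X\<close>, so that distinct elements of \<open>cont_ring X\<close> differ on \<^term>\<open>topspace X\<close>.
  The ring operations are the pointwise ones of \<^theory>\<open>HOL-Library.Function_Algebras\<close>.
\<close>

definition cont_ring :: "'a topology \<Rightarrow> ('a \<Rightarrow> real) set" where
  "cont_ring X = {f. continuous_map X euclideanreal f \<and> (\<forall>x. x \<notin> topspace X \<longrightarrow> f x = 0)}"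

definition zero_set :: "'a topology \<Rightarrow> ('a \<Rightarrow> real) \<Rightarrow> 'a set" where
  "zero_set X f = {x \<in> topspace X. f x = 0}"

definition C_F :: "'a topology \<Rightarrow> ('a \<Rightarrow> real) set" where
  "C_F X = {f \<in> cont_ring X. finite (topspace X - zero_set X f)}"

definition isolated_points :: "'a topology \<Rightarrow> 'a set" where
  "isolated_points X = {x \<in> topspace X. openin X {x}}"

definition tychonoff_space :: "'a topology \<Rightarrow> bool" where
  "tychonoff_space X \<longleftrightarrow> completely_regular_space X \<and> Hausdorff_space X"

lemma subring_set_cont_ring: "subring_set (cont_ring X)"
  by (auto simp: subring_set_def cont_ring_def zero_fun_def fun_diff_def times_fun_def
      intro!: continuous_map_diff continuous_map_real_mult)

lemma subring_set_C_F: "subring_set (C_F X)"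
proof -
  have coz: "f - g \<in> C_F X \<and> f * g \<in> C_F X" if "f \<in> C_F X" "g \<in> C_F X" for f g
  proof -
    have fin: "finite ((topspace X - zero_set X f) \<union> (topspace X - zero_set X g))"
      using that by (simp add: C_F_def)
    have "topspace X - zero_set X (f - g) \<subseteq> (topspace X - zero_set X f) \<union> (topspace X - zero_set X g)"
      "topspace X - zero_set X (f * g) \<subseteq> (topspace X - zero_set X f) \<union> (topspace X - zero_set X g)"
      by (auto simp: zero_set_def)
    then show ?thesis
      using that subring_set_cont_ring[of X] finite_subset[OF _ fin]
      by (simp add: C_F_def subring_set_def)
  qed
  moreover have "0 \<in> C_F X"
    using subring_set_cont_ring[of X] by (simp add: C_F_def subring_set_def zero_set_def)
  ultimately show ?thesis by (simp add: subring_set_def)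
qed

end

theory Submission
  imports Defs "HOL-Library.Disjoint_Sets" "HOL-Algebra.Free_Abelian_Groups"
begin

text \<open>
  A function in \<open>C_F X\<close> vanishes off a finite open set, and in a Hausdorff space such a set consists
  of isolated points. Conversely the indicator of every finite set of isolated points is
  continuous. So, as far as products that vanish are concerned, an element of \<open>C_F X\<close> is the same
  as its cozero set, and the cozero sets are exactly the finite subsets of the set \<open>K\<close> of isolated
  points. The vertices of the annihilator graph are the functions whose cozero set is nonempty and
  different from \<open>K\<close>. Two of them are adjacent if and only if their cozero sets are incomparable
  under inclusion (\<open>adjacent_iff_cozero_incomparable\<close>): a function that kills \<open>f * g\<close> but neither
  \<open>f\<close> nor \<open>g\<close> must be nonzero somewhere on each of the two differences of the cozero sets. So
  cliques are antichains of finite sets, and colour classes are made of chains.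

  It is enough to exhibit a clique and a proper colouring with no more colours than
  the clique has elements. If \<open>K\<close> is infinite, the indicators of single points form a clique,
  and colouring a function by its cozero set uses as many colours as \<open>K\<close> has finite subsets, which
  is again the cardinal of \<open>K\<close>. If \<open>K\<close> has \<open>n\<close> elements, the subsets of size \<open>n div 2\<close> form an
  antichain, and these consist of vertices because \<open>0 < n div 2 < n\<close>. For the colouring, the power
  set of \<open>K\<close> is partitioned into symmetric chains (de Bruijn, Tengbergen, Kruyswijk). Each of
  these passes through the middle layer, so that a set can be coloured with the middle set of its
  own chain.
\<close>

section \<open>Chromatic and clique number from a colouring and a clique\<close>

lemma clique_number_ordLeq_chromatic_number:
  assumes "simple_graph G"
  shows "clique_number G \<le>o chromatic_number G"
proof -
  obtain c where c: "proper_colouring G (Field (chromatic_number G)) c"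
    using chromatic_number_colouring[OF assms] by blast
  have "|S| \<le>o |Field (chromatic_number G)|" if S: "clique G S" for S
  proof -
    have "inj_on c S" "c ` S \<subseteq> Field (chromatic_number G)"
      using c S unfolding proper_colouring_def clique_def pairwise_def inj_on_def by blast+
    then show ?thesis using card_of_ordLeq by blast
  qed
  then have "clique_number G \<le>o |Field (chromatic_number G)|"
    by (rule clique_number_least)
  also have "|Field (chromatic_number G)| =o chromatic_number G"
    using chromatic_number_on_type[OF assms] card_of_Field_ordIso by blast
  finally show ?thesis .
qed

text \<open>
  A clique with at least as many elements as there are colours closes the chain
  \<open>cl \<le> \<chi> \<le> |C| \<le> |S| \<le> cl\<close>.
\<close>

lemma chromatic_and_clique_number_eqI:
  assumes "simple_graph G" "proper_colouring G C c" "clique G S" "|C| \<le>o |S|"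
  shows "chromatic_number G =o clique_number G" "clique_number G =o |C|"
proof -
  have le: "clique_number G \<le>o chromatic_number G"
    using assms(1) by (rule clique_number_ordLeq_chromatic_number)
  have col: "chromatic_number G \<le>o |C|"
    using assms(1,2) by (rule chromatic_number_least)
  have clq: "|C| \<le>o clique_number G"
    using assms(4) clique_number_upper[OF assms(3)] by (rule ordLeq_transitive)
  show "chromatic_number G =o clique_number G"
    using le ordLeq_transitive[OF col clq] by (simp add: ordIso_iff_ordLeq)
  show "clique_number G =o |C|"
    using clq ordLeq_transitive[OF le col] by (simp add: ordIso_iff_ordLeq)
qed

section \<open>Cozero sets and adjacency\<close>

definition cozero :: "('a \<Rightarrow> real) \<Rightarrow> 'a set" where
  "cozero f = {x. f x \<noteq> 0}"

lemma cozero_indicator [simp]: "cozero (indicator A) = A"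
  by (auto simp: cozero_def indicator_def)

lemma cozero_eq_empty_iff: "cozero f = {} \<longleftrightarrow> f = 0"
  by (auto simp: cozero_def fun_eq_iff)

lemma cozero_times: "cozero (f * g) = cozero f \<inter> cozero g"
  by (auto simp: cozero_def)

lemma times_eq_0_iff_cozero_disjoint:
  "f * g = 0 \<longleftrightarrow> cozero f \<inter> cozero g = {}" for f g :: "'a \<Rightarrow> real"
  using cozero_eq_empty_iff[of "f * g"] by (simp add: cozero_times)

text \<open>
  The cozero set is open. When it is finite, removing all of its points but one leaves an open
  set, since finite sets are closed.
\<close>

lemma cozero_C_F:
  assumes "Hausdorff_space X" "f \<in> C_F X"
  shows "finite (cozero f)" "cozero f \<subseteq> isolated_points X"
proof -
  have cont: "continuous_map X euclideanreal f" and out: "\<And>x. x \<notin> topspace X \<Longrightarrow> f x = 0"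
    and fin: "finite (topspace X - zero_set X f)"
    using assms(2) by (auto simp: C_F_def cont_ring_def)
  have coz: "cozero f = topspace X - zero_set X f"
    using out by (auto simp: cozero_def zero_set_def)
  show fin': "finite (cozero f)" using fin coz by simp
  have "cozero f = {x \<in> topspace X. f x \<in> - {0}}"
    using out by (auto simp: cozero_def)
  then have opn: "openin X (cozero f)"
    using openin_continuous_map_preimage[OF cont, of "- {0}"] by (simp add: open_Compl)
  show "cozero f \<subseteq> isolated_points X"
  proof
    fix x assume x: "x \<in> cozero f"
    then have top: "x \<in> topspace X" using coz by simp
    have "closedin X (cozero f - {x})"
      using assms(1) fin' coz by (intro closedin_Hausdorff_finite) auto
    then have "openin X (cozero f - (cozero f - {x}))"
      using opn by (rule openin_diff[rotated])
    moreover have "cozero f - (cozero f - {x}) = {x}" using x by blast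
    ultimately show "x \<in> isolated_points X" using top by (simp add: isolated_points_def)
  qed
qed

text \<open>A finite set of isolated points is both open and closed.\<close>

lemma indicator_in_C_F:
  assumes "Hausdorff_space X" "finite A" "A \<subseteq> isolated_points X"
  shows "indicator A \<in> C_F X"
proof -
  have top: "A \<subseteq> topspace X" using assms(3) by (auto simp: isolated_points_def)
  have "openin X (\<Union>x\<in>A. {x})"
    using assms(3) by (intro openin_Union) (auto simp: isolated_points_def)
  then have opn: "openin X A" by simp
  have "closedin X A"
    using assms(1,2) top by (intro closedin_Hausdorff_finite) auto
  then have opn': "openin X (topspace X - A)" by (simp add: closedin_def)
  have "openin X {x \<in> topspace X. indicat_real A x \<in> U}" for U
  proof -
    have "{x \<in> topspace X. indicat_real A x \<in> U} =
        (if 1 \<in> U then A else {}) \<union> (if 0 \<in> U then topspace X - A else {})"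
      using top by (auto simp: indicator_def)
    then show ?thesis using opn opn' by (simp add: openin_Un)
  qed
  then have "continuous_map X euclideanreal (indicator A)"
    by (simp add: continuous_map_def)
  moreover have "finite (topspace X - zero_set X (indicator A))"
    using assms(2) by (rule finite_subset[rotated]) (auto simp: zero_set_def indicator_def)
  ultimately show ?thesis
    using top by (auto simp: C_F_def cont_ring_def indicator_def)
qed

text \<open>
  The functions annihilated by \<open>f\<close> are those that live on the isolated points outside the cozero
  set of \<open>f\<close>, so that there is a nonzero one as soon as such a point exists.
\<close>

lemma vertices_AG_C_F:
  assumes "Hausdorff_space X"
  shows "f \<in> vertices (AG (C_F X)) \<longleftrightarrow>
    f \<in> C_F X \<and> cozero f \<noteq> {} \<and> cozero f \<noteq> isolated_points X"
proof -
  have "(\<exists>g\<in>C_F X. g \<noteq> 0 \<and> f * g = 0) \<longleftrightarrow> cozero f \<noteq> isolated_points X"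
    if f: "f \<in> C_F X"
  proof
    assume "\<exists>g\<in>C_F X. g \<noteq> 0 \<and> f * g = 0"
    then obtain g where g: "g \<in> C_F X" "cozero g \<noteq> {}" "cozero f \<inter> cozero g = {}"
      unfolding times_eq_0_iff_cozero_disjoint cozero_eq_empty_iff by blast
    then show "cozero f \<noteq> isolated_points X"
      using cozero_C_F(2)[OF assms g(1)] by blast
  next
    assume "cozero f \<noteq> isolated_points X"
    then obtain b where b: "b \<in> isolated_points X" "b \<notin> cozero f"
      using cozero_C_F(2)[OF assms f] by blast
    have "indicator {b} \<noteq> (0 :: 'a \<Rightarrow> real)"
      using cozero_eq_empty_iff[of "indicator {b}"] by simp
    moreover have "f * indicator {b} = 0"
      using b(2) by (simp add: times_eq_0_iff_cozero_disjoint)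
    moreover have "indicator {b} \<in> C_F X"
      using indicator_in_C_F[OF assms] b(1) by simp
    ultimately show "\<exists>g\<in>C_F X. g \<noteq> 0 \<and> f * g = 0" by blast
  qed
  moreover have "f \<in> vertices (AG (C_F X)) \<longleftrightarrow>
      f \<in> C_F X \<and> f \<noteq> 0 \<and> (\<exists>g\<in>C_F X. g \<noteq> 0 \<and> f * g = 0)"
    by (simp add: AG_def nonzero_zero_divisors_def)
  ultimately show ?thesis unfolding cozero_eq_empty_iff by blast
qed

text \<open>
  For points \<open>a\<close> and \<open>b\<close> of the two differences of the cozero sets, the indicator of \<open>{a, b}\<close>
  annihilates \<open>f * g\<close> but neither factor. If one cozero set lies in the other, the product has the
  same annihilator as one of its factors.
\<close>

lemma adjacent_iff_cozero_incomparable: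
  assumes X: "Hausdorff_space X" and f: "f \<in> C_F X" and g: "g \<in> C_F X"
  shows "adjacent (AG (C_F X)) f g \<longleftrightarrow> \<not> cozero f \<subseteq> cozero g \<and> \<not> cozero g \<subseteq> cozero f"
proof -
  have ann: "ann (C_F X) h = {r \<in> C_F X. cozero r \<inter> cozero h = {}}" for h
    by (simp add: ann_def times_eq_0_iff_cozero_disjoint)
  have "ann (C_F X) f \<union> ann (C_F X) g = ann (C_F X) (f * g)"
    if "cozero f \<subseteq> cozero g \<or> cozero g \<subseteq> cozero f"
    using that unfolding ann cozero_times by blast
  moreover have "f \<noteq> g \<and> ann (C_F X) f \<union> ann (C_F X) g \<noteq> ann (C_F X) (f * g)"
    if incomparable: "\<not> cozero f \<subseteq> cozero g" "\<not> cozero g \<subseteq> cozero f"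
  proof -
    obtain a b where a: "a \<in> cozero f" "a \<notin> cozero g" and b: "b \<in> cozero g" "b \<notin> cozero f"
      using incomparable by blast
    have "indicator {a, b} \<in> C_F X"
      using a(1) b(1) cozero_C_F(2)[OF X f] cozero_C_F(2)[OF X g]
      by (intro indicator_in_C_F[OF X]) auto
    then have "indicator {a, b} \<in> ann (C_F X) (f * g)"
      "indicator {a, b} \<notin> ann (C_F X) f \<union> ann (C_F X) g"
      using a b by (auto simp: ann cozero_times)
    then show ?thesis using incomparable by blast
  qed
  ultimately show ?thesis by (auto simp: AG_def)
qed

text \<open>
  This reduces the theorem to the family of finite subsets of the set of isolated points: colours
  there are chains, cliques are antichains.
\<close>

lemma chromatic_and_clique_number_AG_C_F:
  fixes X :: "'a topology" and \<kappa> :: "'a set \<Rightarrow> 'c"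
  defines "K \<equiv> isolated_points X"
  assumes X: "Hausdorff_space X"
    and colours: "\<And>A. finite A \<Longrightarrow> A \<subseteq> K \<Longrightarrow> \<kappa> A \<in> C"
    and chains: "\<And>A B. finite A \<Longrightarrow> A \<subseteq> K \<Longrightarrow> finite B \<Longrightarrow> B \<subseteq> K \<Longrightarrow> \<kappa> A = \<kappa> B \<Longrightarrow>
      A \<subseteq> B \<or> B \<subseteq> A"
    and vertex_sets: "\<And>A. A \<in> \<A> \<Longrightarrow> finite A \<and> A \<subseteq> K \<and> A \<noteq> {} \<and> A \<noteq> K"
    and antichain: "\<And>A B. A \<in> \<A> \<Longrightarrow> B \<in> \<A> \<Longrightarrow> A \<subseteq> B \<Longrightarrow> A = B"
    and few_colours: "|C| \<le>o |\<A>|"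
  shows "chromatic_number (AG (C_F X)) =o clique_number (AG (C_F X))"
    "clique_number (AG (C_F X)) =o |C|"
proof -
  let ?ind = "indicator :: 'a set \<Rightarrow> 'a \<Rightarrow> real"
  note coz = cozero_C_F[OF X, folded K_def]
  note adj = adjacent_iff_cozero_incomparable[OF X]
  have C_F: "f \<in> C_F X" if "f \<in> vertices (AG (C_F X))" for f
    using that by (simp add: vertices_AG_C_F[OF X])
  have ind: "?ind A \<in> C_F X" if "A \<in> \<A>" for A
    using vertex_sets[OF that] indicator_in_C_F[OF X] by (simp add: K_def)
  have colouring: "proper_colouring (AG (C_F X)) C (\<lambda>f. \<kappa> (cozero f))"
    unfolding proper_colouring_def
  proof (intro conjI ballI impI)
    show "(\<lambda>f. \<kappa> (cozero f)) ` vertices (AG (C_F X)) \<subseteq> C"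
      using colours coz C_F by auto
  next
    fix f g
    assume fg: "f \<in> vertices (AG (C_F X))" "g \<in> vertices (AG (C_F X))" "adjacent (AG (C_F X)) f g"
    then have "\<not> (cozero f \<subseteq> cozero g \<or> cozero g \<subseteq> cozero f)"
      using adj C_F by blast
    then show "\<kappa> (cozero f) \<noteq> \<kappa> (cozero g)"
      using chains[of "cozero f" "cozero g"] coz C_F fg(1,2) by blast
  qed
  have clique: "clique (AG (C_F X)) (?ind ` \<A>)"
    unfolding clique_def
  proof
    show "?ind ` \<A> \<subseteq> vertices (AG (C_F X))"
      using vertex_sets ind by (auto simp: vertices_AG_C_F[OF X] K_def)
    show "pairwise (adjacent (AG (C_F X))) (?ind ` \<A>)"
    proof (rule pairwise_imageI)
      fix A B assume AB: "A \<in> \<A>" "B \<in> \<A>" "A \<noteq> B"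
      then have "\<not> A \<subseteq> B" "\<not> B \<subseteq> A" using antichain by blast+
      then show "adjacent (AG (C_F X)) (?ind A) (?ind B)"
        using adj[OF ind ind] AB(1,2) by simp
    qed
  qed
  have "inj_on ?ind \<A>"
    by (metis cozero_indicator inj_onI)
  then have "|\<A>| \<le>o |?ind ` \<A>|"
    using card_of_ordLeq by blast
  then have "|C| \<le>o |?ind ` \<A>|"
    using few_colours ordLeq_transitive by blast
  from chromatic_and_clique_number_eqI[OF simple_graph_AG colouring clique this]
  show "chromatic_number (AG (C_F X)) =o clique_number (AG (C_F X))"
    "clique_number (AG (C_F X)) =o |C|" .
qed

section \<open>Symmetric chain decompositions\<close>

text \<open>
  In a chain \<open>C\<close> of subsets of an \<open>n\<close>-element set, distinct members have distinct sizes. The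
  second condition thus says that \<open>C\<close> has exactly one member of each size from \<open>i\<close> to \<open>n - i\<close>.
\<close>

definition symmetric_chain :: "nat \<Rightarrow> 'a set set \<Rightarrow> bool" where
  "symmetric_chain n C \<longleftrightarrow>
     chain_subset C \<and> (\<exists>i. 2 * i \<le> n \<and> card ` C = {i..n - i})"

text \<open>
  When a point \<open>x\<close> is added to the ground set, a symmetric chain \<open>C\<close> splits the sets \<open>A\<close> with
  \<open>A - {x} \<in> C\<close> into two new symmetric chains, of which the second may be empty. The top \<open>\<Union>C\<close> is
  extended by \<open>x\<close> within the first chain, which leaves for the second one the sets that arise
  by inserting \<open>x\<close> into the other members of \<open>C\<close>.
\<close>

definition extended_chain :: "'a \<Rightarrow> 'a set set \<Rightarrow> 'a set set" where
  "extended_chain x C = insert (insert x (\<Union>C)) C"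

definition shifted_chain :: "'a \<Rightarrow> 'a set set \<Rightarrow> 'a set set" where
  "shifted_chain x C = insert x ` (C - {\<Union>C})"

lemma
  assumes C: "symmetric_chain n C" and K: "finite K" "C \<subseteq> Pow K" "x \<notin> K"
  shows symmetric_chain_extended: "symmetric_chain (Suc n) (extended_chain x C)"
    and symmetric_chain_shifted:
      "shifted_chain x C \<noteq> {} \<Longrightarrow> symmetric_chain (Suc n) (shifted_chain x C)"
    and symmetric_chain_top: "\<Union>C \<in> C"
proof -
  obtain i where ch: "chain_subset C" and i: "2 * i \<le> n" "card ` C = {i..n - i}"
    using C by (auto simp: symmetric_chain_def)
  have fin: "finite A" "x \<notin> A" if "A \<in> C" for A
    using that K finite_subset by blast+
  have "C \<noteq> {}" using i by force
  moreover have "finite C" using K finite_subset by blast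
  ultimately show top: "\<Union>C \<in> C"
    using ch Union_in_chain[of C UNIV] by (simp add: chain_subset_alt_def)
  have less: "card A < card (\<Union>C)" if "A \<in> C" "A \<noteq> \<Union>C" for A
    using that fin(1)[OF top] by (intro psubset_card_mono) auto
  have card_top: "card (\<Union>C) = n - i"
  proof -
    have "n - i \<in> card ` C" using i by simp
    then obtain A where "A \<in> C" "card A = n - i" by auto
    moreover have "card (\<Union>C) \<le> n - i" using top i(2) by force
    ultimately show ?thesis using less[of A] by (cases "A = \<Union>C") auto
  qed
  have "card ` extended_chain x C = insert (Suc (n - i)) {i..n - i}"
    using i fin[OF top] card_top by (simp add: extended_chain_def)
  also have "\<dots> = {i..Suc n - i}" using i(1) by auto
  finally have "card ` extended_chain x C = {i..Suc n - i}" .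
  moreover have "chain_subset (extended_chain x C)"
    using ch by (auto simp: chain_subset_def extended_chain_def)
  ultimately show "symmetric_chain (Suc n) (extended_chain x C)"
    using i(1) unfolding symmetric_chain_def by (intro conjI exI[of _ i]) auto
  assume ne: "shifted_chain x C \<noteq> {}"
  have rest: "card ` (C - {\<Union>C}) = {i..<n - i}"
  proof (intro subset_antisym subsetI)
    fix m assume m: "m \<in> card ` (C - {\<Union>C})"
    then have "m \<in> {i..n - i}" using i(2) by blast
    moreover have "m < n - i" using m less card_top by auto
    ultimately show "m \<in> {i..<n - i}" by simp
  next
    fix m assume m: "m \<in> {i..<n - i}"
    then have "m \<in> card ` C" using i(2) by simp
    then show "m \<in> card ` (C - {\<Union>C})" using m card_top by auto
  qed
  have "card ` shifted_chain x C = (\<lambda>A. Suc (card A)) ` (C - {\<Union>C})"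
    unfolding shifted_chain_def image_image using fin by (intro image_cong) auto
  also have "\<dots> = Suc ` card ` (C - {\<Union>C})" by (simp only: image_image)
  also have "\<dots> = {Suc i..<Suc (n - i)}" by (simp only: rest image_Suc_atLeastLessThan)
  also have "\<dots> = {Suc i..Suc n - Suc i}" by auto
  finally have "card ` shifted_chain x C = {Suc i..Suc n - Suc i}" .
  moreover have "{i..<n - i} \<noteq> {}"
    using ne unfolding shifted_chain_def rest[symmetric] by blast
  moreover have "chain_subset (shifted_chain x C)"
    using ch by (auto simp: chain_subset_def shifted_chain_def)
  ultimately show "symmetric_chain (Suc n) (shifted_chain x C)"
    unfolding symmetric_chain_def by (intro conjI exI[of _ "Suc i"]) auto
qed

theorem symmetric_chain_decomposition:
  assumes "finite K"
  shows "\<exists>D. partition_on (Pow K) D \<and> (\<forall>C\<in>D. symmetric_chain (card K) C)"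
  using assms
proof (induction K rule: finite_induct)
  case empty
  have "partition_on (Pow {}) {{{}}}" by (simp add: partition_on_def)
  moreover have "symmetric_chain 0 {{}}" by (auto simp: symmetric_chain_def chain_subset_def)
  ultimately show ?case by fastforce
next
  case (insert x K)
  then obtain D where part: "partition_on (Pow K) D"
    and sym: "\<And>C. C \<in> D \<Longrightarrow> symmetric_chain (card K) C" by blast
  have sub: "C \<subseteq> Pow K" if "C \<in> D" for C
    using that partition_onD1[OF part] by blast
  have uniq: "C = C'" if "C \<in> D" "C' \<in> D" "A \<in> C" "A \<in> C'" for A C C'
    using that partition_onD2[OF part] by (auto simp: disjoint_def)
  have top: "\<Union>C \<in> C" if "C \<in> D" for C
    using symmetric_chain_top[OF sym[OF that] insert(1) sub[OF that] insert(2)] .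
  define E where "E = extended_chain x ` D \<union> (shifted_chain x ` D - {{}})"
  \<comment> \<open>A set \<open>A\<close> determines the old chain behind its new chain, as the member of \<open>D\<close> that contains
    \<open>A - {x}\<close>, and also which of the two new chains it is in. This makes the new chains disjoint.\<close>
  have ext: "A - {x} \<in> C \<and> (x \<in> A \<longrightarrow> A - {x} = \<Union>C)"
    if C: "C \<in> D" and A: "A \<in> extended_chain x C" for A C
  proof -
    have new: "x \<notin> B" if "B \<in> C" for B
      using that sub[OF C] insert(2) by blast
    consider "A = insert x (\<Union>C)" | "A \<in> C"
      using A by (auto simp: extended_chain_def)
    then show ?thesis
    proof cases
      case 1
      have "x \<notin> \<Union>C" using new by blast
      then have "A - {x} = \<Union>C" using 1 by blast
      then show ?thesis using top[OF C] by simp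
    next
      case 2
      then show ?thesis using new[OF 2] by simp
    qed
  qed
  have shf: "A - {x} \<in> C \<and> x \<in> A \<and> A - {x} \<noteq> \<Union>C"
    if C: "C \<in> D" and A: "A \<in> shifted_chain x C" for A C
  proof -
    obtain B where B: "B \<in> C" "B \<noteq> \<Union>C" "A = insert x B"
      using A by (auto simp: shifted_chain_def)
    moreover have "x \<notin> B" using B(1) sub[OF C] insert(2) by blast
    ultimately show ?thesis by simp
  qed
  have "partition_on (Pow (insert x K)) E"
  proof (rule partition_onI)
    show "\<Union>E = Pow (insert x K)"
    proof
      show "\<Union>E \<subseteq> Pow (insert x K)"
      proof
        fix A assume "A \<in> \<Union>E"
        then obtain C where C: "C \<in> D" "A \<in> extended_chain x C \<or> A \<in> shifted_chain x C"
          by (auto simp: E_def)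
        then have "A - {x} \<in> C" using ext[OF C(1)] shf[OF C(1)] by blast
        then have "A - {x} \<subseteq> K" using sub[OF C(1)] by blast
        then show "A \<in> Pow (insert x K)" by blast
      qed
      show "Pow (insert x K) \<subseteq> \<Union>E"
      proof
        fix A assume "A \<in> Pow (insert x K)"
        then have "A - {x} \<in> Pow K" by blast
        then have "A - {x} \<in> \<Union>D" by (simp only: partition_onD1[OF part])
        then obtain C where C: "C \<in> D" "A - {x} \<in> C" by blast
        have "A \<in> extended_chain x C \<or> A \<in> shifted_chain x C"
        proof (cases "x \<in> A")
          case True
          then have eq: "insert x (A - {x}) = A" by (rule insert_Diff)
          show ?thesis
          proof (cases "A - {x} = \<Union>C")
            case True
            then have "insert x (\<Union>C) = A" using eq by (simp only:)
            then show ?thesis by (simp add: extended_chain_def)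
          next
            case False
            then have "insert x (A - {x}) \<in> shifted_chain x C"
              unfolding shifted_chain_def using C(2) by (intro imageI) simp
            then show ?thesis by (simp only: eq simp_thms)
          qed
        next
          case False
          then show ?thesis using C(2) by (simp add: extended_chain_def)
        qed
        then show "A \<in> \<Union>E" using C(1) unfolding E_def by blast
      qed
    qed
    show "{} \<notin> E" by (auto simp: E_def extended_chain_def)
  next
    fix M N assume MN: "M \<in> E" "N \<in> E" "M \<noteq> N"
    show "disjnt M N"
    proof (rule ccontr)
      assume "\<not> disjnt M N"
      then obtain A where A: "A \<in> M" "A \<in> N" by (auto simp: disjnt_def)
      from MN(1) obtain C where C: "C \<in> D" "M = extended_chain x C \<or> M = shifted_chain x C"
        by (auto simp: E_def)
      from MN(2) obtain C' where C': "C' \<in> D" "N = extended_chain x C' \<or> N = shifted_chain x C'"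
        by (auto simp: E_def)
      have "A - {x} \<in> C" "A - {x} \<in> C'" using A C C' ext shf by metis+
      then have "C = C'" using uniq C(1) C'(1) by blast
      then show False using A C C' MN(3) ext shf by metis
    qed
  qed
  moreover have "symmetric_chain (card (insert x K)) M" if M_E: "M \<in> E" for M
  proof -
    obtain C where C: "C \<in> D" and M: "M = extended_chain x C \<or> M = shifted_chain x C \<and> M \<noteq> {}"
      using M_E by (auto simp: E_def)
    note facts = sym[OF C] insert(1) sub[OF C] insert(2)
    show ?thesis
      using M symmetric_chain_extended[OF facts] symmetric_chain_shifted[OF facts] insert(1,2) by auto
  qed
  ultimately show ?case by blast
qed

text \<open>
  Every symmetric chain meets the middle layer, and disjoint chains meet it in different sets.
\<close>

lemma chain_colouring_by_middle_layer:
  assumes "finite K"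
  obtains \<kappa> where "\<And>A. A \<subseteq> K \<Longrightarrow> \<kappa> A \<subseteq> K \<and> card (\<kappa> A) = card K div 2"
    and "\<And>A B. A \<subseteq> K \<Longrightarrow> B \<subseteq> K \<Longrightarrow> \<kappa> A = \<kappa> B \<Longrightarrow> A \<subseteq> B \<or> B \<subseteq> A"
proof -
  obtain D where part: "partition_on (Pow K) D" and sym: "\<And>C. C \<in> D \<Longrightarrow> symmetric_chain (card K) C"
    using symmetric_chain_decomposition[OF assms] by blast
  have "\<exists>M. \<exists>C\<in>D. A \<in> C \<and> M \<in> C \<and> card M = card K div 2" if "A \<subseteq> K" for A
  proof -
    have "A \<in> \<Union>D" using that partition_onD1[OF part] by blast
    then obtain C where C: "C \<in> D" "A \<in> C" by blast
    obtain i where i: "2 * i \<le> card K" "card ` C = {i..card K - i}"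
      using sym[OF C(1)] by (auto simp: symmetric_chain_def)
    have "i \<le> card K div 2 \<and> card K div 2 \<le> card K - i" using i(1) by linarith
    then have "card K div 2 \<in> card ` C" by (simp add: i(2))
    then obtain M where "M \<in> C" "card M = card K div 2" by force
    then show ?thesis using C by blast
  qed
  then obtain \<kappa> where \<kappa>: "\<And>A. A \<subseteq> K \<Longrightarrow> \<exists>C\<in>D. A \<in> C \<and> \<kappa> A \<in> C \<and> card (\<kappa> A) = card K div 2"
    by metis
  show ?thesis
  proof
    show "\<kappa> A \<subseteq> K \<and> card (\<kappa> A) = card K div 2" if "A \<subseteq> K" for A
      using \<kappa>[OF that] partition_onD1[OF part] by blast
    show "A \<subseteq> B \<or> B \<subseteq> A" if AB: "A \<subseteq> K" "B \<subseteq> K" "\<kappa> A = \<kappa> B" for A B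
    proof -
      obtain C where C: "C \<in> D" "A \<in> C" "\<kappa> A \<in> C" using \<kappa>[OF AB(1)] by blast
      obtain C' where C': "C' \<in> D" "B \<in> C'" "\<kappa> A \<in> C'" using \<kappa>[OF AB(2)] AB(3) by auto
      have "C = C'"
        using C C' partition_onD2[OF part] by (auto simp: disjoint_def)
      then show ?thesis
        using C C' sym[OF C(1)] by (auto simp: symmetric_chain_def chain_subset_def)
    qed
  qed
qed

section \<open>The chromatic and clique number of the annihilator graph\<close>

theorem theorem5p7:
  fixes X :: "'a topology"
  assumes "tychonoff_space X"
    and "infinite (isolated_points X) \<or> card (isolated_points X) \<ge> 3"
  shows "chromatic_number (AG (C_F X)) =o clique_number (AG (C_F X)) \<and>
         (if finite (isolated_points X)
          then clique_number (AG (C_F X)) =o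
                 |{..<card (isolated_points X) choose (card (isolated_points X) div 2)}|
          else clique_number (AG (C_F X)) =o |isolated_points X| )"
proof -
  let ?K = "isolated_points X"
  have X: "Hausdorff_space X" using assms(1) by (simp add: tychonoff_space_def)
  show ?thesis
  proof (cases "finite ?K")
    case True
    let ?k = "card ?K div 2"
    define \<M> where "\<M> = {B. B \<subseteq> ?K \<and> card B = ?k}"
    obtain \<kappa> where \<kappa>: "\<And>A. A \<subseteq> ?K \<Longrightarrow> \<kappa> A \<subseteq> ?K \<and> card (\<kappa> A) = ?k"
      "\<And>A B. A \<subseteq> ?K \<Longrightarrow> B \<subseteq> ?K \<Longrightarrow> \<kappa> A = \<kappa> B \<Longrightarrow> A \<subseteq> B \<or> B \<subseteq> A"
      using chain_colouring_by_middle_layer[OF True] by metis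
    have k: "0 < ?k" "?k < card ?K" using assms(2) True by auto
    have fin: "finite A" if "A \<subseteq> ?K" for A
      using that True by (rule finite_subset)
    have vertex_sets: "finite A \<and> A \<subseteq> ?K \<and> A \<noteq> {} \<and> A \<noteq> ?K" if "A \<in> \<M>" for A
    proof -
      have A: "A \<subseteq> ?K" "card A = ?k" using that by (simp_all add: \<M>_def)
      then have "card A \<noteq> card {}" "card A \<noteq> card ?K" using k by simp_all
      then show ?thesis using A(1) fin[OF A(1)] by blast
    qed
    have antichain: "A = B" if "A \<in> \<M>" "B \<in> \<M>" "A \<subseteq> B" for A B
    proof (rule card_subset_eq)
      show "finite B" using that(2) fin by (simp add: \<M>_def)
      show "card A = card B" using that(1,2) by (simp add: \<M>_def)
    qed (rule that(3))
    have colours: "\<kappa> A \<in> \<M>" if "finite A" "A \<subseteq> ?K" for A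
      using \<kappa>(1)[OF that(2)] by (simp add: \<M>_def)
    have chains: "A \<subseteq> B \<or> B \<subseteq> A"
      if "finite A" "A \<subseteq> ?K" "finite B" "B \<subseteq> ?K" "\<kappa> A = \<kappa> B" for A B
      using \<kappa>(2)[OF that(2,4,5)] .
    note \<M> = chromatic_and_clique_number_AG_C_F
      [OF X colours chains vertex_sets antichain card_of_mono1[OF subset_refl]]
    have "finite \<M>" "card \<M> = card {..<card ?K choose ?k}"
      using True n_subsets[OF True] by (simp_all add: \<M>_def)
    then obtain h where "bij_betw h \<M> {..<card ?K choose ?k}"
      using finite_same_card_bij[OF _ finite_lessThan] by metis
    then have card: "|\<M>| =o |{..<card ?K choose ?k}|"
      using card_of_ordIso by blast
    show ?thesis
      unfolding if_P[OF True] using \<M>(1) ordIso_transitive[OF \<M>(2) card] ..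
  next
    case False
    let ?S = "(\<lambda>x. {x}) ` ?K"
    have "inj_on (\<lambda>x. {x}) ?K" by simp
    then have S: "|?K| \<le>o |?S|" using card_of_ordLeq by blast
    have Fpow: "|Fpow ?K| =o |?K|"
      using False by (rule card_of_Fpow_infinite)
    have few: "|Fpow ?K| \<le>o |?S|"
      using Fpow S by (rule ordIso_ordLeq_trans)
    have vertex_sets: "finite A \<and> A \<subseteq> ?K \<and> A \<noteq> {} \<and> A \<noteq> ?K" if "A \<in> ?S" for A
    proof -
      have "finite A" "A \<subseteq> ?K" "A \<noteq> {}" using that by auto
      then show ?thesis using False by blast
    qed
    have colours: "A \<in> Fpow ?K" if "finite A" "A \<subseteq> ?K" for A
      using that by (simp add: Fpow_def)
    have chains: "A \<subseteq> B \<or> B \<subseteq> A"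
      if "finite A" "A \<subseteq> ?K" "finite B" "B \<subseteq> ?K" "A = B" for A B
      using that(5) by blast
    have antichain: "A = B" if "A \<in> ?S" "B \<in> ?S" "A \<subseteq> B" for A B
      using that by auto
    note main = chromatic_and_clique_number_AG_C_F
      [where \<kappa> = "\<lambda>A. A", OF X colours chains vertex_sets antichain few]
    show ?thesis
      unfolding if_not_P[OF False] using main(1) ordIso_transitive[OF main(2) Fpow] ..
  qed
qed

end
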